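(* Let $d\ge1$. Suppose that $\{g_n\}_{n\in\mathbb{Z}}\in\ell^1(\mathbb{Z})$ satisfies $g_0=1$ and $$\mu:=g_0-\sum_{n\neq0}|g_n|>0.$$ If $f\in L^1_{\mathrm{loc}}(\mathbb{R}^d)$ (complex-valued) satisfies $$-\operatorname{Im}f(x)\ge\begin{cases}|x|^{-k},&|x|>R_0,\\0,&|x|\le R_0,\end{cases}$$ for some $k\le d$ and $R_0>0$, then there exist $C=C(k,R_0,\mu)>0$ and $\varepsilon_0>0$ such that $$T_{\max}(\varepsilon f)\le\begin{cases}C\,\varepsilon^{-\frac{2}{d-k}},&k<d,\\ \exp(C/\varepsilon),&k=d\end{cases}$$ holds for any $\varepsilon\in(0,\varepsilon_0)$.
   Context: Nonlinearity: $F:\mathbb{C}\to\mathbb{C}$ is homogeneous of degree $1+2/d$, i.e. $F(\lambda z)=\lambda^{1+2/d}F(z)$ for all $z\in\mathbb{C}$, $\lambda>0$. Its coefficients are $g_n=\frac1{2\pi}\int_0^{2\pi}F(e^{i\theta})e^{-in\theta}\,d\theta$, $n\in\mathbb{Z}$, and $F$ is decomposed as $F(u)=\sum_{n\in\mathbb{Z}}g_n|u|^{1+\frac2d-n}u^n$. The equation is $i\partial_tu+\Delta u=F(u)$ for complex-valued $u(t,x)$, $(t,x)\in\mathbb{R}^{1+d}$. Weak solution: suppose $F$ is locally uniformly bounded and let $T>0$. A function $u(t,x)\in\mathcal{S}'((-\infty,T)\times\mathbb{R}^d)$ is a weak solution on $[0,T)$ with initial condition $u(0,x)=u_0(x)\in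 L^1_{\mathrm{loc}}(\mathbb{R}^d)$ if $u\in L^{(d+2)/d}_{\mathrm{loc}}((0,T)\times\mathbb{R}^d)$ and $$\int_{(0,T)\times\mathbb{R}^d}u(-i\partial_t\psi+\Delta\psi)\,dx\,dt=i\int_{\mathbb{R}^d}u_0(x)\psi(0,x)\,dx+\int_{(0,T)\times\mathbb{R}^d}F(u)\psi\,dx\,dt$$ for every $\psi\in C_0^\infty((-\infty,T)\times\mathbb{R}^d)$. Maximal existence time: for $u_0\in L^1_{\mathrm{loc}}(\mathbb{R}^d)$, $T_{\max}(u_0)=\sup\{T>0:\text{there exists a weak solution }u\text{ with }u(0)=u_0\text{ on }[0,T)\}$. Uniqueness of weak solutions is not assumed. *)

theory Defs
  imports "HOL-Analysis.Analysis"
begin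

section \<open>Smooth functions and test functions\<close>

definition dir_deriv :: "'e::real_normed_vector \<Rightarrow> ('e \<Rightarrow> complex) \<Rightarrow> 'e \<Rightarrow> complex" where
  "dir_deriv v f x = frechet_derivative f (at x) v"

primrec times_cont_diff :: "nat \<Rightarrow> ('e::euclidean_space \<Rightarrow> complex) \<Rightarrow> bool" where
  "times_cont_diff 0 f \<longleftrightarrow> continuous_on UNIV f"
| "times_cont_diff (Suc n) f \<longleftrightarrow>
     (\<forall>x. f differentiable (at x)) \<and> (\<forall>v. times_cont_diff n (dir_deriv v f))"

definition smooth :: "('e::euclidean_space \<Rightarrow> complex) \<Rightarrow> bool" where
  "smooth f \<longleftrightarrow> (\<forall>n. times_cont_diff n f)"

definition support :: "('e::topological_space \<Rightarrow> complex) \<Rightarrow> 'e set" where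
  "support f = closure {x. f x \<noteq> 0}"

text \<open>Elements of \<open>C\<^sub>0\<^sup>\<infinity>(\<Omega>)\<close>, extended by zero to the whole space.\<close>

definition test_functions :: "'e::euclidean_space set \<Rightarrow> ('e \<Rightarrow> complex) set" where
  "test_functions \<Omega> = {\<psi>. smooth \<psi> \<and> compact (support \<psi>) \<and> support \<psi> \<subseteq> \<Omega>}"

section \<open>Local Lebesgue spaces and tempered distributions\<close>

definition Lp_loc :: "real \<Rightarrow> 'e::euclidean_space set \<Rightarrow> ('e \<Rightarrow> complex) \<Rightarrow> bool" where
  "Lp_loc p \<Omega> u \<longleftrightarrow> u \<in> borel_measurable (lebesgue_on \<Omega>) \<and>
     (\<forall>K. compact K \<and> K \<subseteq> \<Omega> \<longrightarrow> set_integrable lebesgue K (\<lambda>x. norm (u x) powr p))"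

text \<open>A list of basis vectors plays the role of a multi-index.\<close>

primrec iter_deriv :: "'e::real_normed_vector list \<Rightarrow> ('e \<Rightarrow> complex) \<Rightarrow> 'e \<Rightarrow> complex" where
  "iter_deriv [] f = f"
| "iter_deriv (v # vs) f = dir_deriv v (iter_deriv vs f)"

definition schwartz_values :: "nat \<Rightarrow> ('e::euclidean_space \<Rightarrow> complex) \<Rightarrow> real set" where
  "schwartz_values N \<phi> =
     {(1 + norm x) ^ N * norm (iter_deriv vs \<phi> x) | x vs. set vs \<subseteq> Basis \<and> length vs \<le> N}"

definition schwartz_functions :: "('e::euclidean_space \<Rightarrow> complex) set" where
  "schwartz_functions = {\<phi>. smooth \<phi> \<and> (\<forall>N. bdd_above (schwartz_values N \<phi>))}"

definition schwartz_seminorm :: "nat \<Rightarrow> ('e::euclidean_space \<Rightarrow> complex) \<Rightarrow> real" where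
  "schwartz_seminorm N \<phi> = Sup (schwartz_values N \<phi>)"

definition tempered_distribution :: "(('e::euclidean_space \<Rightarrow> complex) \<Rightarrow> complex) \<Rightarrow> bool" where
  "tempered_distribution \<Lambda> \<longleftrightarrow>
     (\<forall>\<phi>\<in>schwartz_functions. \<forall>\<eta>\<in>schwartz_functions. \<forall>a b.
        \<Lambda> (\<lambda>x. a * \<phi> x + b * \<eta> x) = a * \<Lambda> \<phi> + b * \<Lambda> \<eta>) \<and>
     (\<exists>N B. \<forall>\<phi>\<in>schwartz_functions. norm (\<Lambda> \<phi>) \<le> B * schwartz_seminorm N \<phi>)"

text \<open>
  A function belongs to \<open>\<S>'(\<Omega>)\<close> if, as a distribution on \<open>\<Omega>\<close>, it is the restriction
  of a tempered distribution on the whole space.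
\<close>

definition tempered_function_on :: "'e::euclidean_space set \<Rightarrow> ('e \<Rightarrow> complex) \<Rightarrow> bool" where
  "tempered_function_on \<Omega> u \<longleftrightarrow> Lp_loc 1 \<Omega> u \<and>
     (\<exists>\<Lambda>. tempered_distribution \<Lambda> \<and>
        (\<forall>\<phi>\<in>test_functions \<Omega>. \<Lambda> \<phi> = (LINT x:\<Omega>|lebesgue. u x * \<phi> x)))"

section \<open>The nonlinearity\<close>

definition fourier_coeff :: "(complex \<Rightarrow> complex) \<Rightarrow> int \<Rightarrow> complex" where
  "fourier_coeff F n =
     complex_of_real (1 / (2 * pi)) *
     (LINT \<theta>:{0..2 * pi}|lebesgue.
        F (exp (\<i> * complex_of_real \<theta>)) * exp (- \<i> * of_int n * complex_of_real \<theta>))"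

text \<open>
  At \<open>z = 0\<close> every term of the expansion is \<open>0\<close>, because \<open>0 powr a = 0\<close>; this agrees with
  \<open>F 0 = 0\<close>, which homogeneity forces.
\<close>

definition critical_nonlinearity :: "nat \<Rightarrow> (complex \<Rightarrow> complex) \<Rightarrow> bool" where
  "critical_nonlinearity d F \<longleftrightarrow>
     (\<forall>z. \<forall>r>0. F (complex_of_real r * z) = complex_of_real (r powr (1 + 2 / real d)) * F z) \<and>
     (\<forall>z. ((\<lambda>n::int. fourier_coeff F n *
              complex_of_real (norm z powr (1 + 2 / real d - of_int n)) * z powi n)
            has_sum F z) UNIV)"

section \<open>Weak solutions of the equation\<close>

text \<open>Space-time points are pairs \<open>(t, x)\<close>; the spatial dimension is \<open>DIM('a)\<close>.\<close>

definition time_deriv :: "(real \<times> 'a::euclidean_space \<Rightarrow> complex) \<Rightarrow> real \<times> 'a \<Rightarrow> complex" where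
  "time_deriv \<psi> = dir_deriv (1, 0) \<psi>"

definition space_laplacian :: "(real \<times> 'a::euclidean_space \<Rightarrow> complex) \<Rightarrow> real \<times> 'a \<Rightarrow> complex" where
  "space_laplacian \<psi> z = (\<Sum>b\<in>Basis. dir_deriv (0, b) (dir_deriv (0, b) \<psi>) z)"

text \<open>
  Test functions need not vanish at \<open>t = 0\<close>, while membership in \<open>L\<^sub>l\<^sub>o\<^sub>c\<close> of the open strip says
  nothing near \<open>t = 0\<close>. That the integrals in the identity exist is therefore part of the
  definition; otherwise the value \<open>0\<close> of a non-integrable integrand would enter.
\<close>

definition weak_solution ::
  "(complex \<Rightarrow> complex) \<Rightarrow> real \<Rightarrow> ('a::euclidean_space \<Rightarrow> complex) \<Rightarrow> (real \<times> 'a \<Rightarrow> complex) \<Rightarrow> bool"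
  where
  "weak_solution F T u0 u \<longleftrightarrow>
     Lp_loc 1 UNIV u0 \<and>
     tempered_function_on ({..<T} \<times> UNIV) u \<and>
     Lp_loc ((real DIM('a) + 2) / real DIM('a)) ({0<..<T} \<times> UNIV) u \<and>
     (\<forall>\<psi>\<in>test_functions ({..<T} \<times> UNIV).
        set_integrable lebesgue ({0<..<T} \<times> UNIV)
          (\<lambda>z. u z * (- \<i> * time_deriv \<psi> z + space_laplacian \<psi> z)) \<and>
        set_integrable lebesgue ({0<..<T} \<times> UNIV) (\<lambda>z. F (u z) * \<psi> z) \<and>
        (LINT z:{0<..<T} \<times> UNIV|lebesgue. u z * (- \<i> * time_deriv \<psi> z + space_laplacian \<psi> z)) =
          \<i> * (LINT x|lebesgue. u0 x * \<psi> (0, x)) +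
          (LINT z:{0<..<T} \<times> UNIV|lebesgue. F (u z) * \<psi> z))"

definition T_max :: "(complex \<Rightarrow> complex) \<Rightarrow> ('a::euclidean_space \<Rightarrow> complex) \<Rightarrow> ennreal" where
  "T_max F u0 = Sup {ennreal T | T. T > 0 \<and> (\<exists>u. weak_solution F T u0 u)}"

end

theory Submission imports Defs begin

text \<open>
  The proof is by the test function method. Write \<open>d\<close> for the dimension and \<open>p = 1 + 2 / d\<close>. Since the
  mean \<open>g\<^sub>0 = 1\<close> of the nonlinearity dominates its other Fourier coefficients, \<open>Re (F z) \<ge> \<mu> * \<bar>z\<bar> powr p\<close>
  (lemma \<open>Re_nonlinearity_lower_bound\<close>). Let \<open>u\<close> be a weak solution on \<open>[0, T)\<close> with datum \<open>\<epsilon> * f\<close>, let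
  \<open>\<tau> < T\<close>, and test the equation with a nonnegative real bump \<open>\<psi>\<close> living on the parabolic scale
  \<open>\<bar>t\<bar> \<le> \<tau>\<close>, \<open>\<bar>x\<bar>\<^sup>2 \<le> \<tau>\<close>. The real part of the identity bounds
  \<open>\<mu> * \<integral>\<bar>u\<bar>\<^sup>p\<psi> + \<epsilon> * \<integral>(- Im f) \<psi>(0, \<cdot>)\<close> by \<open>\<integral>\<bar>u\<bar> * \<bar>- \<i>\<partial>\<^sub>t\<psi> + \<Delta>\<psi>\<bar>\<close>.

  If the derivatives of \<open>\<psi>\<close> are bounded by \<open>(B / \<tau>) * \<psi> powr (1 / p)\<close>, then Young's inequality absorbs the
  right-hand side into the first term on the left, up to a remainder of order
  \<open>\<tau> powr (- (1 + d / 2))\<close> times the volume of the support. That volume is of order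
  \<open>\<tau> powr (1 + d / 2)\<close>, so \<open>\<epsilon> * \<integral>(- Im f) \<psi>(0, \<cdot>)\<close> is bounded by a constant \<open>M\<close> independent of \<open>\<tau>\<close>,
  of \<open>u\<close>, and of \<open>\<epsilon>\<close> (lemma \<open>test_function_estimate\<close>). On the other hand, the lower bound on \<open>- Im f\<close>
  makes the integral grow like \<open>\<tau> powr ((d - k) / 2)\<close> for \<open>k < d\<close> and like \<open>ln \<tau>\<close> for \<open>k = d\<close>
  (lemma \<open>initial_data_lower_bound\<close>). Comparing the two gives the bounds on \<open>\<tau>\<close>, hence on \<open>T\<close>.

  The bump is \<open>exp (- 1 / s)\<close> with \<open>s = 1 - t\<^sup>2 / \<tau>\<^sup>2 - \<bar>x\<bar>\<^sup>2 / \<tau>\<close>, continued by zero. Its derivatives carry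
  only additional powers of \<open>1 / s\<close>, which any small part of the exponential absorbs; this is how
  the bound by \<open>\<psi> powr (1 / p)\<close> arises (lemma \<open>bump_operator_bound\<close>).
\<close>

section \<open>Flat functions on the line\<close>

text \<open>
  The derivatives of the classical function \<open>exp (- 1 / s)\<close>, extended by zero to \<open>s \<le> 0\<close>, are
  linear combinations of the functions \<open>flat m\<close>. Using this family throughout keeps all
  derivatives of the test function explicit.
\<close>

definition flat :: "nat \<Rightarrow> real \<Rightarrow> real" where
  "flat m s = (if s > 0 then exp (- 1 / s) / s ^ m else 0)"

lemma flat_nonneg: "0 \<le> flat m s"
  by (simp add: flat_def)

lemma power_le_exp:
  fixes y :: real assumes "0 \<le> y"
  shows "y ^ n \<le> fact n * exp y"
proof -
  have "y ^ n / fact n \<le> (\<Sum>i<Suc n. y ^ i / fact i)"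
    using assms by (intro member_le_sum) auto
  also have "\<dots> \<le> (\<Sum>i. y ^ i / fact i)"
    using assms summable_exp_generic[of y]
    by (intro sum_le_suminf) (auto simp: divide_inverse mult.commute)
  also have "\<dots> = exp y"
    by (simp add: exp_def divide_inverse mult.commute)
  finally show ?thesis
    by (simp add: field_simps)
qed

text \<open>
  For \<open>s > 0\<close> and \<open>y = 1 / s\<close> this says \<open>y ^ m * exp (- c * y) \<le> fact m / c ^ m\<close>. It lets derivatives of the
  test function \<open>\<psi>\<close> be absorbed by \<open>\<psi> powr (1 / p)\<close>, with \<open>1 / p = 1 - c\<close>: the factor that the
  nonlinear term supplies for Young's inequality.
\<close>

lemma flat_le_powr:
  assumes "0 < c"
  shows "flat m s \<le> fact m / c ^ m * flat 0 s powr (1 - c)"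
proof (cases "s > 0")
  case True
  have "(c * (1 / s)) ^ m \<le> fact m * exp (c * (1 / s))"
    using assms True by (intro power_le_exp) auto
  hence "(1 / s) ^ m \<le> fact m / c ^ m * exp (c / s)"
    using assms by (simp add: field_simps power_mult_distrib)
  hence "(1 / s) ^ m * exp (- 1 / s) \<le> fact m / c ^ m * exp (c / s) * exp (- 1 / s)"
    by (intro mult_right_mono) auto
  also have "\<dots> = fact m / c ^ m * exp (- 1 / s) powr (1 - c)"
    using True by (simp add: powr_def mult_exp_exp field_simps)
  finally show ?thesis
    using True by (simp add: flat_def power_one_over)
qed (simp add: flat_def)

text \<open>
  Quadratic decay makes \<open>flat m\<close> differentiable at \<open>0\<close>, the point where its two formulas meet.
\<close>

lemma flat_le_square: "\<bar>flat m s\<bar> \<le> fact (m + 2) * s\<^sup>2"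
proof (cases "s > 0")
  case True
  have "(1 / s) ^ (m + 2) \<le> fact (m + 2) * exp (1 / s)"
    using True by (intro power_le_exp) auto
  hence "(1 / s) ^ (m + 2) * (s\<^sup>2 * exp (- 1 / s)) \<le> fact (m + 2) * exp (1 / s) * (s\<^sup>2 * exp (- 1 / s))"
    by (intro mult_right_mono) auto
  also have "\<dots> = fact (m + 2) * s\<^sup>2"
    by (simp add: exp_minus)
  also have "(1 / s) ^ (m + 2) * (s\<^sup>2 * exp (- 1 / s)) = flat m s"
    using True by (simp add: flat_def power_add field_simps power2_eq_square)
  finally show ?thesis
    by (simp add: flat_nonneg)
qed (simp add: flat_def)

lemma has_real_derivative_flat:
  "(flat m has_real_derivative flat (m + 2) s - m * flat (m + 1) s) (at s)"
proof -
  consider "s > 0" | "s < 0" | "s = 0" by linarith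
  thus ?thesis
  proof cases
    case 1
    have "((\<lambda>s. exp (- 1 / s) / s ^ m) has_real_derivative flat (m + 2) s - m * flat (m + 1) s) (at s)"
    proof -
      have e: "((\<lambda>s. exp (- 1 / s)) has_real_derivative exp (- 1 / s) / s\<^sup>2) (at s)"
        using 1 by (auto intro!: derivative_eq_intros simp: power2_eq_square)
      have "real m * s ^ (m - Suc 0) = real m * s ^ m / s"
        using 1 by (cases m) auto
      hence pow: "((\<lambda>s. s ^ m) has_real_derivative real m * s ^ m / s) (at s)"
        using DERIV_pow[of m s UNIV] by simp
      show ?thesis
        by (rule DERIV_cong[OF DERIV_divide[OF e pow]])
          (use 1 in \<open>auto simp: flat_def power2_eq_square field_simps\<close>)
    qed
    thus ?thesis
      by (rule has_field_derivative_transform_within_open[of _ _ _ "{0<..}"])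
        (use 1 in \<open>auto simp: flat_def\<close>)
  next
    case 2
    have "((\<lambda>_. 0) has_real_derivative flat (m + 2) s - m * flat (m + 1) s) (at s)"
      using 2 by (simp add: flat_def)
    thus ?thesis
      by (rule has_field_derivative_transform_within_open[of _ _ _ "{..<0}"])
        (use 2 in \<open>auto simp: flat_def\<close>)
  next
    case 3
    have "((\<lambda>h. flat m h / h) \<longlongrightarrow> 0) (at 0)"
    proof (rule Lim_null_comparison)
      show "eventually (\<lambda>h. norm (flat m h / h) \<le> fact (m + 2) * \<bar>h\<bar>) (at 0)"
        using flat_le_square[of m]
        by (intro eventually_at_filter[THEN iffD2] always_eventually)
          (auto simp: divide_simps power2_eq_square mult.assoc abs_mult)
      show "((\<lambda>h. fact (m + 2) * \<bar>h\<bar>) \<longlongrightarrow> (0::real)) (at 0)"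
        by (auto intro!: tendsto_eq_intros)
    qed
    thus ?thesis
      using 3 by (simp add: DERIV_def flat_def)
  qed
qed

section \<open>Smoothness of flat functions composed with a quadratic form\<close>

text \<open>
  Smoothness of \<open>flat m \<circ> q\<close> cannot be proved by induction on the order of differentiation alone,
  since the derivatives leave the family. This algebra is closed under all directional derivatives
  as soon as the gradient of \<open>q\<close> is linear in the point, so that the induction goes through on its elements.
\<close>

inductive_set bump_algebra :: "('e::euclidean_space \<Rightarrow> real) \<Rightarrow> ('e \<Rightarrow> complex) set" for q where
  const: "(\<lambda>_. c) \<in> bump_algebra q"
| inner: "(\<lambda>z. complex_of_real (z \<bullet> w)) \<in> bump_algebra q"
| flat: "(\<lambda>z. complex_of_real (flat m (q z))) \<in> bump_algebra q"
| add: "f \<in> bump_algebra q \<Longrightarrow> g \<in> bump_algebra q \<Longrightarrow> (\<lambda>z. f z + g z) \<in> bump_algebra q"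
| mult: "f \<in> bump_algebra q \<Longrightarrow> g \<in> bump_algebra q \<Longrightarrow> (\<lambda>z. f z * g z) \<in> bump_algebra q"

lemma has_derivative_flat_comp:
  assumes "(q has_derivative q') (at z)"
  shows "((\<lambda>z. complex_of_real (flat m (q z))) has_derivative
           (\<lambda>v. complex_of_real ((flat (m + 2) (q z) - m * flat (m + 1) (q z)) * q' v))) (at z)"
proof -
  have "((\<lambda>z. flat m (q z)) has_derivative
           (\<lambda>v. q' v * (flat (m + 2) (q z) - m * flat (m + 1) (q z)))) (at z)"
    using DERIV_compose_FDERIV[OF has_real_derivative_flat assms] .
  from has_derivative_of_real[OF this, where ?'a = complex] show ?thesis
    by (simp only: mult.commute)
qed

lemma bump_algebra_derivative:
  fixes q :: "'e::euclidean_space \<Rightarrow> real"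
  assumes q: "\<And>z. (q has_derivative (\<lambda>v. z \<bullet> A v)) (at z)"
  assumes "f \<in> bump_algebra q"
  shows "\<exists>D. (\<forall>z. (f has_derivative D z) (at z)) \<and> (\<forall>v. (\<lambda>z. D z v) \<in> bump_algebra q)"
  using assms(2)
proof induction
  case (const c)
  show ?case
    by (intro exI[of _ "\<lambda>_ _. 0"]) (auto intro: bump_algebra.const)
next
  case (inner w)
  show ?case
    by (intro exI[of _ "\<lambda>_ v. complex_of_real (v \<bullet> w)"])
      (auto intro: bump_algebra.const intro!: derivative_eq_intros)
next
  case (flat m)
  have "(\<lambda>z. complex_of_real ((flat (m + 2) (q z) - m * flat (m + 1) (q z)) * (z \<bullet> A v)))
        \<in> bump_algebra q" for v
  proof -
    have "(\<lambda>z. (complex_of_real (flat (m + 2) (q z)) + - of_nat m * complex_of_real (flat (m + 1) (q z)))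
           * complex_of_real (z \<bullet> A v)) \<in> bump_algebra q"
      by (intro bump_algebra.intros)
    thus ?thesis by simp
  qed
  thus ?case
    using has_derivative_flat_comp[OF q] by (intro exI conjI allI) assumption+
next
  case (add f g)
  then obtain D E where "\<forall>z. (f has_derivative D z) (at z)" "\<forall>v. (\<lambda>z. D z v) \<in> bump_algebra q"
    "\<forall>z. (g has_derivative E z) (at z)" "\<forall>v. (\<lambda>z. E z v) \<in> bump_algebra q" by blast
  thus ?case
    by (intro exI[of _ "\<lambda>z v. D z v + E z v"])
      (auto intro: bump_algebra.add has_derivative_add)
next
  case (mult f g)
  then obtain D E where DE: "\<forall>z. (f has_derivative D z) (at z)" "\<forall>v. (\<lambda>z. D z v) \<in> bump_algebra q"
    "\<forall>z. (g has_derivative E z) (at z)" "\<forall>v. (\<lambda>z. E z v) \<in> bump_algebra q" by blast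
  show ?case
  proof (intro exI[of _ "\<lambda>z v. f z * E z v + D z v * g z"] conjI allI)
    show "((\<lambda>z. f z * g z) has_derivative (\<lambda>v. f z * E z v + D z v * g z)) (at z)" for z
      using DE by (intro has_derivative_mult) auto
    show "(\<lambda>z. f z * E z v + D z v * g z) \<in> bump_algebra q" for v
      using DE mult.hyps by (auto intro!: bump_algebra.add bump_algebra.mult)
  qed
qed

lemma dir_deriv_eq: "(f has_derivative D) (at z) \<Longrightarrow> dir_deriv v f z = D v"
  by (simp add: dir_deriv_def frechet_derivative_at[symmetric])

lemma bump_algebra_smooth:
  fixes q :: "'e::euclidean_space \<Rightarrow> real"
  assumes q: "\<And>z. (q has_derivative (\<lambda>v. z \<bullet> A v)) (at z)"
  assumes "f \<in> bump_algebra q"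
  shows "smooth f"
proof -
  have "times_cont_diff n f" for n
    using assms(2)
  proof (induction n arbitrary: f)
    case 0
    then obtain D where "\<forall>z. (f has_derivative D z) (at z)"
      using bump_algebra_derivative[OF q] by blast
    thus ?case
      by (auto intro!: continuous_at_imp_continuous_on has_derivative_continuous)
  next
    case (Suc n)
    then obtain D where D: "\<forall>z. (f has_derivative D z) (at z)" "\<forall>v. (\<lambda>z. D z v) \<in> bump_algebra q"
      using bump_algebra_derivative[OF q] by blast
    have "dir_deriv v f = (\<lambda>z. D z v)" for v
      using D by (auto intro: dir_deriv_eq)
    thus ?case
      using D Suc.IH by (auto simp: differentiable_def)
  qed
  thus ?thesis by (simp add: smooth_def)
qed

section \<open>The parabolic bump\<close>

text \<open>
  The level sets respect the parabolic scaling \<open>t \<sim> \<tau>\<close>, \<open>\<bar>x\<bar> \<sim> sqrt \<tau>\<close> of the equation. The exponent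
  \<open>1 + 2 / d\<close> is the one for which the resulting estimate does not depend on \<open>\<tau>\<close>.
\<close>

definition parabolic_form :: "real \<Rightarrow> real \<times> 'a::euclidean_space \<Rightarrow> real" where
  "parabolic_form \<tau> z = 1 - (fst z)\<^sup>2 / \<tau>\<^sup>2 - (norm (snd z))\<^sup>2 / \<tau>"

definition parabolic_bump :: "real \<Rightarrow> real \<times> 'a::euclidean_space \<Rightarrow> complex" where
  "parabolic_bump \<tau> z = complex_of_real (flat 0 (parabolic_form \<tau> z))"

lemma parabolic_form_has_derivative:
  "(parabolic_form \<tau> has_derivative (\<lambda>v. z \<bullet> ((- 2 / \<tau>\<^sup>2) * fst v, (- 2 / \<tau>) *\<^sub>R snd v))) (at z)"
  unfolding parabolic_form_def power2_norm_eq_inner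
  by (auto intro!: derivative_eq_intros simp: inner_prod_def fun_eq_iff inner_commute algebra_simps
      power2_eq_square divide_inverse)

lemma smooth_bump: "smooth (parabolic_bump \<tau>)"
  by (rule bump_algebra_smooth[OF parabolic_form_has_derivative])
    (auto simp: parabolic_bump_def[abs_def] intro: bump_algebra.flat)

lemma parabolic_form_nonneg_bounds:
  assumes "0 < \<tau>" "0 \<le> parabolic_form \<tau> z"
  shows "\<bar>fst z\<bar> \<le> \<tau>" "(norm (snd z))\<^sup>2 \<le> \<tau>"
proof -
  have *: "(fst z)\<^sup>2 / \<tau>\<^sup>2 + (norm (snd z))\<^sup>2 / \<tau> \<le> 1"
    using assms by (simp add: parabolic_form_def)
  have "0 \<le> (fst z)\<^sup>2 / \<tau>\<^sup>2" "0 \<le> (norm (snd z))\<^sup>2 / \<tau>"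
    using assms by auto
  with * have "(fst z)\<^sup>2 / \<tau>\<^sup>2 \<le> 1" "(norm (snd z))\<^sup>2 / \<tau> \<le> 1"
    by linarith+
  hence "(fst z)\<^sup>2 \<le> \<tau>\<^sup>2" and 2: "(norm (snd z))\<^sup>2 \<le> \<tau>"
    using assms by (auto simp: field_simps)
  thus "\<bar>fst z\<bar> \<le> \<tau>"
    using assms abs_le_square_iff[of "fst z" \<tau>] by simp
  show "(norm (snd z))\<^sup>2 \<le> \<tau>" by (rule 2)
qed

definition parabolic_box :: "real \<Rightarrow> (real \<times> 'a::euclidean_space) set" where
  "parabolic_box \<tau> = cbox (- \<tau>, - (sqrt \<tau> *\<^sub>R One)) (\<tau>, sqrt \<tau> *\<^sub>R One)"

lemma parabolic_form_nonneg_in_parabolic_box: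
  assumes "0 < \<tau>" "0 \<le> parabolic_form \<tau> z"
  shows "z \<in> parabolic_box \<tau>"
proof -
  have "\<bar>snd z \<bullet> b\<bar> \<le> sqrt \<tau>" if "b \<in> Basis" for b
  proof -
    have "\<bar>snd z \<bullet> b\<bar> \<le> norm (snd z)" using that by (rule Basis_le_norm)
    also have "\<dots> \<le> sqrt \<tau>" using parabolic_form_nonneg_bounds(2)[OF assms] by (rule real_le_rsqrt)
    finally show ?thesis .
  qed
  thus ?thesis
    using parabolic_form_nonneg_bounds(1)[OF assms]
    by (cases z) (auto simp: parabolic_box_def cbox_Pair_eq mem_box abs_le_iff minus_le_iff)
qed

lemma measure_parabolic_box:
  assumes "0 < \<tau>"
  shows "measure lebesgue (parabolic_box \<tau> :: (real \<times> 'a::euclidean_space) set) =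
           2 ^ (DIM('a) + 1) * \<tau> powr ((real DIM('a) + 2) / 2)"
proof -
  have "measure lborel (cbox (- (sqrt \<tau> *\<^sub>R One)) (sqrt \<tau> *\<^sub>R One) :: 'a set) = (\<Prod>i\<in>(Basis :: 'a set). 2 * sqrt \<tau>)"
    using assms by (subst content_cbox) auto
  also have "\<dots> = 2 ^ DIM('a) * (\<tau> powr (1/2)) ^ DIM('a)"
    using assms by (simp add: power_mult_distrib powr_half_sqrt)
  also have "(\<tau> powr (1/2)) ^ DIM('a) = \<tau> powr (real DIM('a) / 2)"
    using assms by (simp add: powr_power)
  finally show ?thesis
    using assms unfolding parabolic_box_def
    by (simp add: content_Pair add_divide_distrib powr_add)
qed

lemma parabolic_bump_test_function:
  assumes "0 < \<tau>" "\<tau> < T"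
  shows "parabolic_bump \<tau> \<in> test_functions ({..<T} \<times> (UNIV :: 'a::euclidean_space set))"
proof -
  have cont: "continuous_on UNIV (parabolic_form \<tau> :: real \<times> 'a \<Rightarrow> real)"
    by (auto intro!: continuous_at_imp_continuous_on has_derivative_continuous[OF parabolic_form_has_derivative])
  have "closed {z :: real \<times> 'a. 0 \<le> parabolic_form \<tau> z}"
    by (intro closed_Collect_le cont continuous_intros)
  moreover have "{z. parabolic_bump \<tau> z \<noteq> 0} \<subseteq> {z :: real \<times> 'a. 0 \<le> parabolic_form \<tau> z}"
    by (auto simp: parabolic_bump_def flat_def split: if_splits)
  ultimately have sub: "support (parabolic_bump \<tau>) \<subseteq> {z :: real \<times> 'a. 0 \<le> parabolic_form \<tau> z}"
    unfolding support_def by (rule closure_minimal[rotated])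
  also have "\<dots> \<subseteq> parabolic_box \<tau>"
    using parabolic_form_nonneg_in_parabolic_box[OF assms(1)] by blast
  finally have sub2: "support (parabolic_bump \<tau> :: real \<times> 'a \<Rightarrow> complex) \<subseteq> parabolic_box \<tau>" .
  have "compact (support (parabolic_bump \<tau> :: real \<times> 'a \<Rightarrow> complex))"
    unfolding compact_eq_bounded_closed
    using bounded_subset[OF _ sub2] by (auto simp: parabolic_box_def support_def)
  moreover have "support (parabolic_bump \<tau> :: real \<times> 'a \<Rightarrow> complex) \<subseteq> {..<T} \<times> UNIV"
    using sub parabolic_form_nonneg_bounds(1)[OF assms(1)] assms(2) by fastforce
  ultimately show ?thesis
    by (simp add: test_functions_def smooth_bump)
qed

lemma time_deriv_bump:
  "time_deriv (parabolic_bump \<tau>) z = complex_of_real (- 2 * fst z / \<tau>\<^sup>2 * flat 2 (parabolic_form \<tau> z))"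
proof -
  have "(parabolic_bump \<tau> has_derivative (\<lambda>v. complex_of_real ((flat (0 + 2) (parabolic_form \<tau> z) - real 0 * flat (0 + 1) (parabolic_form \<tau> z)) *
      (z \<bullet> ((- 2 / \<tau>\<^sup>2) * fst v, (- 2 / \<tau>) *\<^sub>R snd v))))) (at z)"
    unfolding parabolic_bump_def by (rule has_derivative_flat_comp[OF parabolic_form_has_derivative])
  from dir_deriv_eq[OF this, of "(1, 0)"] show ?thesis
    by (simp add: numeral_2_eq_2[symmetric] time_deriv_def inner_prod_def)
qed

lemma dir_deriv_bump:
  "dir_deriv (0, b) (parabolic_bump \<tau>) z = complex_of_real (- 2 * (snd z \<bullet> b) / \<tau> * flat 2 (parabolic_form \<tau> z))"
proof -
  have "(parabolic_bump \<tau> has_derivative (\<lambda>v. complex_of_real ((flat (0 + 2) (parabolic_form \<tau> z) - real 0 * flat (0 + 1) (parabolic_form \<tau> z)) *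
      (z \<bullet> ((- 2 / \<tau>\<^sup>2) * fst v, (- 2 / \<tau>) *\<^sub>R snd v))))) (at z)"
    unfolding parabolic_bump_def by (rule has_derivative_flat_comp[OF parabolic_form_has_derivative])
  from dir_deriv_eq[OF this, of "(0, b)"] show ?thesis
    by (simp add: numeral_2_eq_2[symmetric] inner_prod_def)
qed

lemma space_laplacian_bump:
  fixes z :: "real \<times> 'a::euclidean_space"
  shows "space_laplacian (parabolic_bump \<tau>) z = complex_of_real
    (4 * (norm (snd z))\<^sup>2 / \<tau>\<^sup>2 * (flat 4 (parabolic_form \<tau> z) - 2 * flat 3 (parabolic_form \<tau> z))
      - 2 * real DIM('a) / \<tau> * flat 2 (parabolic_form \<tau> z))"
proof -
  have second: "dir_deriv (0, b) (dir_deriv (0, b) (parabolic_bump \<tau>)) z = complex_of_real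
    (4 / \<tau>\<^sup>2 * (flat 4 (parabolic_form \<tau> z) - 2 * flat 3 (parabolic_form \<tau> z)) * (snd z \<bullet> b)\<^sup>2 - 2 / \<tau> * flat 2 (parabolic_form \<tau> z))"
    if "b \<in> Basis" for b :: 'a
  proof -
    have eq: "dir_deriv (0, b) (parabolic_bump \<tau>) = (\<lambda>z. complex_of_real (- 2 / \<tau> * (snd z \<bullet> b)) * complex_of_real (flat 2 (parabolic_form \<tau> z)))"
      by (simp add: dir_deriv_bump fun_eq_iff)
    have lin: "((\<lambda>z. complex_of_real (c * (snd z \<bullet> b))) has_derivative
        (\<lambda>v. complex_of_real (c * (snd v \<bullet> b)))) (at z)" for c
      by (auto intro!: derivative_eq_intros)
    note * = has_derivative_mult[OF lin[of "- 2 / \<tau>"] has_derivative_flat_comp[OF parabolic_form_has_derivative[of \<tau> z], of 2]]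
    have "dir_deriv (0, b) (dir_deriv (0, b) (parabolic_bump \<tau>)) z = 
       complex_of_real (- 2 / \<tau> * (snd z \<bullet> b)) *
         complex_of_real ((flat (2 + 2) (parabolic_form \<tau> z) - real 2 * flat (2 + 1) (parabolic_form \<tau> z)) *
          (z \<bullet> ((- 2 / \<tau>\<^sup>2) * 0, (- 2 / \<tau>) *\<^sub>R b)))
       + complex_of_real (- 2 / \<tau> * (b \<bullet> b)) * complex_of_real (flat 2 (parabolic_form \<tau> z))"
      unfolding eq using dir_deriv_eq[OF *, of "(0, b)"] by simp
    also have "z \<bullet> ((- 2 / \<tau>\<^sup>2) * 0, (- 2 / \<tau>) *\<^sub>R b) = - 2 / \<tau> * (snd z \<bullet> b)"
      by (simp add: inner_prod_def)
    also have "2 + 2 = (4::nat)" by simp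
    also have "2 + 1 = (3::nat)" by simp
    also have "b \<bullet> b = 1" using that by simp
    finally have "dir_deriv (0, b) (dir_deriv (0, b) (parabolic_bump \<tau>)) z = complex_of_real
      (- 2 / \<tau> * (snd z \<bullet> b) * ((flat 4 (parabolic_form \<tau> z) - 2 * flat 3 (parabolic_form \<tau> z)) * (- 2 / \<tau> * (snd z \<bullet> b)))
        + - 2 / \<tau> * 1 * flat 2 (parabolic_form \<tau> z))"
      by (simp only: of_real_mult of_real_add of_nat_numeral)
    also have "\<dots> = complex_of_real
      (4 / \<tau>\<^sup>2 * (flat 4 (parabolic_form \<tau> z) - 2 * flat 3 (parabolic_form \<tau> z)) * (snd z \<bullet> b)\<^sup>2 - 2 / \<tau> * flat 2 (parabolic_form \<tau> z))"
      by (rule arg_cong[of _ _ complex_of_real]) (simp add: power2_eq_square divide_inverse algebra_simps)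
    finally show ?thesis .
  qed
  have "space_laplacian (parabolic_bump \<tau>) z = complex_of_real (\<Sum>b\<in>Basis.
     4 / \<tau>\<^sup>2 * (flat 4 (parabolic_form \<tau> z) - 2 * flat 3 (parabolic_form \<tau> z)) * (snd z \<bullet> b)\<^sup>2 - 2 / \<tau> * flat 2 (parabolic_form \<tau> z))"
    unfolding space_laplacian_def of_real_sum by (intro sum.cong refl second)
  also have "\<dots> = complex_of_real (4 / \<tau>\<^sup>2 * (flat 4 (parabolic_form \<tau> z) - 2 * flat 3 (parabolic_form \<tau> z)) * (\<Sum>b\<in>Basis. (snd z \<bullet> b)\<^sup>2)
     - real DIM('a) * (2 / \<tau> * flat 2 (parabolic_form \<tau> z)))"
    by (simp add: sum_subtractf sum_distrib_left)
  also have "(\<Sum>b\<in>Basis. (snd z \<bullet> b)\<^sup>2) = (norm (snd z))\<^sup>2"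
    unfolding power2_norm_eq_inner by (subst euclidean_inner) (simp add: power2_eq_square)
  finally show ?thesis by (simp add: mult_ac)
qed

text \<open>
  One time derivative and two space derivatives both cost a factor \<open>1 / \<tau>\<close>, because
  \<open>\<bar>t\<bar> \<le> \<tau>\<close> and \<open>\<bar>x\<bar>\<^sup>2 \<le> \<tau>\<close> on the support. What remains is a combination of \<open>flat 2\<close>, \<open>flat 3\<close> and
  \<open>flat 4\<close>, each of which is bounded by a power of \<open>flat 0\<close> with exponent below \<open>1\<close>.
\<close>

lemma bump_operator_bound:
  fixes c :: real
  assumes "0 < c"
  shows "\<exists>B>0. \<forall>\<tau>>0. \<forall>z::real \<times> 'a::euclidean_space.
    norm (- \<i> * time_deriv (parabolic_bump \<tau>) z + space_laplacian (parabolic_bump \<tau>) z)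
      \<le> B / \<tau> * flat 0 (parabolic_form \<tau> z) powr (1 - c)"
proof -
  define K :: "nat \<Rightarrow> real" where "K m = fact m / c ^ m" for m
  have K: "flat m s \<le> K m * flat 0 s powr (1 - c)" "K m > 0" for m s
    using flat_le_powr[OF assms] assms by (auto simp: K_def)
  define B where "B = (2 + 2 * real DIM('a)) * K 2 + 8 * K 3 + 4 * K 4"
  have "norm (- \<i> * time_deriv (parabolic_bump \<tau>) z + space_laplacian (parabolic_bump \<tau>) z)
      \<le> B / \<tau> * flat 0 (parabolic_form \<tau> z) powr (1 - c)" if \<tau>: "0 < \<tau>" for \<tau> and z :: "real \<times> 'a"
  proof (cases "0 \<le> parabolic_form \<tau> z")
    case False
    thus ?thesis by (simp add: time_deriv_bump space_laplacian_bump flat_def)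
  next
    case True
    define G where "G m = flat m (parabolic_form \<tau> z)" for m
    have G: "G m \<ge> 0" for m by (simp add: G_def flat_nonneg)
    have "norm (time_deriv (parabolic_bump \<tau>) z) = 2 * \<bar>fst z\<bar> / \<tau>\<^sup>2 * G 2"
      using G[of 2] by (simp add: time_deriv_bump norm_mult norm_divide norm_power G_def)
    also have "\<dots> \<le> 2 * \<tau> / \<tau>\<^sup>2 * G 2"
      using parabolic_form_nonneg_bounds[OF \<tau> True] \<tau> G by (intro mult_right_mono divide_right_mono) auto
    also have "\<dots> = (2 * G 2) / \<tau>" using \<tau> by (simp add: power2_eq_square)
    finally have 1: "norm (time_deriv (parabolic_bump \<tau>) z) \<le> (2 * G 2) / \<tau>" .
    have "norm (space_laplacian (parabolic_bump \<tau>) z) =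
        \<bar>4 * (norm (snd z))\<^sup>2 / \<tau>\<^sup>2 * (G 4 - 2 * G 3) - 2 * real DIM('a) / \<tau> * G 2\<bar>"
      unfolding space_laplacian_bump norm_of_real G_def ..
    also have "\<dots> \<le> \<bar>4 * (norm (snd z))\<^sup>2 / \<tau>\<^sup>2 * (G 4 - 2 * G 3)\<bar> + 2 * real DIM('a) / \<tau> * G 2"
      using \<tau> G[of 2] by (intro order_trans[OF abs_triangle_ineq4]) auto
    also have "\<bar>4 * (norm (snd z))\<^sup>2 / \<tau>\<^sup>2 * (G 4 - 2 * G 3)\<bar> = 4 * (norm (snd z))\<^sup>2 / \<tau>\<^sup>2 * \<bar>G 4 - 2 * G 3\<bar>"
      by (simp add: abs_mult)
    also have "\<dots> \<le> 4 * \<tau> / \<tau>\<^sup>2 * (G 4 + 2 * G 3)"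
      using parabolic_form_nonneg_bounds[OF \<tau> True] \<tau> G[of 3] G[of 4] by (intro mult_mono divide_right_mono) auto
    also have "\<dots> = (4 * G 4 + 8 * G 3) / \<tau>"
      using \<tau> by (simp add: power2_eq_square field_simps)
    finally have 2: "norm (space_laplacian (parabolic_bump \<tau>) z)
        \<le> (4 * G 4 + 8 * G 3) / \<tau> + 2 * real DIM('a) / \<tau> * G 2" by simp
    have "norm (- \<i> * time_deriv (parabolic_bump \<tau>) z + space_laplacian (parabolic_bump \<tau>) z)
        \<le> norm (time_deriv (parabolic_bump \<tau>) z) + norm (space_laplacian (parabolic_bump \<tau>) z)"
      by (rule order_trans[OF norm_triangle_ineq]) (simp add: norm_mult)
    also have "\<dots> \<le> ((2 + 2 * real DIM('a)) * G 2 + 8 * G 3 + 4 * G 4) / \<tau>"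
      using 1 2 by (simp add: algebra_simps add_divide_distrib)
    also have "\<dots> \<le> ((2 + 2 * real DIM('a)) * (K 2 * flat 0 (parabolic_form \<tau> z) powr (1 - c))
        + 8 * (K 3 * flat 0 (parabolic_form \<tau> z) powr (1 - c)) + 4 * (K 4 * flat 0 (parabolic_form \<tau> z) powr (1 - c))) / \<tau>"
      using \<tau> unfolding G_def by (intro divide_right_mono add_mono mult_left_mono K) auto
    also have "\<dots> = B / \<tau> * flat 0 (parabolic_form \<tau> z) powr (1 - c)"
      by (simp add: B_def algebra_simps)
    finally show ?thesis .
  qed
  moreover have "B > 0"
    unfolding B_def using K(2) by (intro add_pos_pos mult_pos_pos) auto
  ultimately show ?thesis by blast
qed

section \<open>Coercivity of the nonlinearity and the a priori estimate\<close>

text \<open>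
  Each term of the expansion has modulus \<open>\<bar>g\<^sub>n\<bar> * \<bar>z\<bar> powr p\<close>, and the term with \<open>n = 0\<close> is
  \<open>\<bar>z\<bar> powr p\<close> itself; \<open>\<mu>\<close> is the margin by which it exceeds the sum of the others, relative to \<open>\<bar>z\<bar> powr p\<close>.
\<close>

lemma Re_nonlinearity_lower_bound:
  assumes "critical_nonlinearity d F"
    and "(\<lambda>n. norm (fourier_coeff F n)) summable_on UNIV"
    and "fourier_coeff F 0 = 1"
    and "complex_of_real \<mu> =
      fourier_coeff F 0 - complex_of_real (\<Sum>\<^sub>\<infinity>n\<in>{n. n \<noteq> 0}. norm (fourier_coeff F n))"
  shows "\<mu> * norm z powr (1 + 2 / real d) \<le> Re (F z)"
proof -
  define p where "p = 1 + 2 / real d"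
  define h where "h n = fourier_coeff F n * complex_of_real (norm z powr (p - of_int n)) * z powi n" for n
  have hs: "(h has_sum F z) UNIV"
    using assms(1) by (simp add: critical_nonlinearity_def h_def[abs_def] p_def)
  have norm_h: "norm (h n) = norm (fourier_coeff F n) * norm z powr p" for n
  proof (cases "z = 0")
    case False
    have "norm z powr (p - of_int n) * norm z powi n = norm z powr p"
      using False by (simp add: powr_real_of_int' [symmetric] flip: powr_add)
    thus ?thesis
      by (simp add: h_def norm_mult norm_power_int)
  qed (simp add: h_def)
  have h0: "h 0 = complex_of_real (norm z powr p)"
    using assms(3) by (simp add: h_def)
  have hs': "(h has_sum (F z - h 0)) (UNIV - {0})"
    using has_sum_finite[of "{0}" h] by (intro has_sum_Diff[OF hs]) auto
  have "(\<lambda>n. norm (fourier_coeff F n)) summable_on (UNIV - {0})"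
    by (rule summable_on_subset_banach[OF assms(2)]) auto
  hence sum: "((\<lambda>n. norm (fourier_coeff F n)) has_sum (1 - \<mu>)) (UNIV - {0})"
  proof -
    have "complex_of_real \<mu> = complex_of_real (1 - (\<Sum>\<^sub>\<infinity>n\<in>{n. n \<noteq> 0}. norm (fourier_coeff F n)))"
      using assms(3,4) by simp
    hence "(\<Sum>\<^sub>\<infinity>n\<in>{n. n \<noteq> 0}. norm (fourier_coeff F n)) = 1 - \<mu>"
      unfolding of_real_eq_iff by simp
    moreover have "{n. n \<noteq> 0} = UNIV - {0::int}" by auto
    ultimately show ?thesis
      using has_sum_infsum[OF \<open>_ summable_on (UNIV - {0})\<close>] by simp
  qed
  have "norm (F z - h 0) \<le> (1 - \<mu>) * norm z powr p"
  proof (rule norm_has_sum_bound[OF _ hs'])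
    show "((\<lambda>n. norm (h n)) has_sum (1 - \<mu>) * norm z powr p) (UNIV - {0})"
      unfolding norm_h by (rule has_sum_cmult_left[OF sum])
  qed
  moreover have "\<bar>Re (F z - h 0)\<bar> \<le> norm (F z - h 0)"
    by (rule abs_Re_le_cmod)
  ultimately have "- ((1 - \<mu>) * norm z powr p) \<le> Re (F z) - norm z powr p"
    by (simp add: h0)
  thus ?thesis by (simp add: p_def algebra_simps)
qed

text \<open>
  Young's inequality for the exponents \<open>1 + 2 / d\<close> and \<open>1 + d / 2\<close>, with a constant that is not
  optimal: the product is at most the first summand if \<open>b \<le> \<mu> * a powr (2 / d)\<close>, and otherwise
  solving for \<open>a\<close> bounds it by the second.
\<close>

lemma young_power:
  fixes a b \<mu> d :: real
  assumes "0 \<le> a" "0 \<le> b" "0 < \<mu>" "0 < d"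
  shows "a * b \<le> \<mu> * a powr (1 + 2 / d) + \<mu> powr (- (d / 2)) * b powr (1 + d / 2)"
proof (cases "b \<le> \<mu> * a powr (2 / d)")
  case True
  have "a * b \<le> a * (\<mu> * a powr (2 / d))"
    using True assms by (intro mult_left_mono)
  also have "\<dots> = \<mu> * a powr (1 + 2 / d)"
    using assms by (cases "a = 0") (auto simp: powr_add)
  finally show ?thesis
    using assms by (intro order_trans[OF _ le_add_same_cancel1[THEN iffD2]]) auto
next
  case False
  have "b > 0" using False assms
    by (smt (verit) mult_nonneg_nonneg powr_ge_zero)
  have "a = (a powr (2 / d)) powr (d / 2)"
    using assms by (simp add: powr_powr)
  also have "\<dots> \<le> (b / \<mu>) powr (d / 2)"
    using False assms by (intro powr_mono2) (auto simp: field_simps)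
  finally have "a * b \<le> (b / \<mu>) powr (d / 2) * b"
    using assms by (intro mult_right_mono)
  also have "\<dots> = \<mu> powr (- (d / 2)) * b powr (1 + d / 2)"
  proof -
    have "b powr (1 + d / 2) = b * b powr (d / 2)"
      using \<open>b > 0\<close> by (subst powr_add) simp
    moreover have "(b / \<mu>) powr (d / 2) = b powr (d / 2) / \<mu> powr (d / 2)"
      using assms by (simp add: powr_divide)
    moreover have "\<mu> powr (- (d / 2)) = 1 / \<mu> powr (d / 2)"
      by (rule powr_minus_divide)
    ultimately show ?thesis by simp
  qed
  finally show ?thesis
    using assms by (intro order_trans[OF _ le_add_same_cancel2[THEN iffD2]]) auto
qed

lemma continuous_flat: "continuous_on UNIV (flat m)"
  using has_real_derivative_flat by (intro continuous_at_imp_continuous_on) (auto intro: DERIV_isCont)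

lemma flat_0_le_1: "flat 0 s \<le> 1"
  by (simp add: flat_def)

lemma flat_0_mono: "s \<le> t \<Longrightarrow> flat 0 s \<le> flat 0 t"
  by (auto simp: flat_def field_simps)

lemma parabolic_form_0: "parabolic_form \<tau> (0, x) = 1 - (norm x)\<^sup>2 / \<tau>"
  by (simp add: parabolic_form_def)

lemma integrable_initial:
  assumes "Lp_loc 1 UNIV u0" "0 < \<tau>"
  shows "integrable lebesgue (\<lambda>x::'a::euclidean_space. u0 x * parabolic_bump \<tau> (0, x))"
proof (rule Bochner_Integration.integrable_bound)
  show "integrable lebesgue (\<lambda>x. indicator (cball 0 (sqrt \<tau>)) x *\<^sub>R norm (u0 x) powr 1)"
    using assms(1) unfolding Lp_loc_def set_integrable_def by auto
  have 1: "u0 \<in> borel_measurable lebesgue"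
    using assms(1) by (simp add: Lp_loc_def lebesgue_on_UNIV_eq)
  have "continuous_on UNIV (\<lambda>x::'a. parabolic_bump \<tau> (0, x))"
    unfolding parabolic_bump_def parabolic_form_0
    by (intro continuous_intros continuous_on_compose2[OF continuous_flat]) (use assms in auto)
  hence "(\<lambda>x::'a. parabolic_bump \<tau> (0, x)) \<in> borel_measurable borel"
    by (rule borel_measurable_continuous_onI)
  hence 2: "(\<lambda>x::'a. parabolic_bump \<tau> (0, x)) \<in> borel_measurable lebesgue"
    by (intro measurable_completion) simp
  show "(\<lambda>x. u0 x * parabolic_bump \<tau> (0, x)) \<in> borel_measurable lebesgue"
    using 1 2 by (rule borel_measurable_times)
  show "AE x in lebesgue. norm (u0 x * parabolic_bump \<tau> (0, x))
          \<le> norm (indicator (cball 0 (sqrt \<tau>)) x *\<^sub>R norm (u0 x) powr 1)"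
  proof (intro AE_I2)
    fix x :: 'a
    show "norm (u0 x * parabolic_bump \<tau> (0, x)) \<le> norm (indicator (cball 0 (sqrt \<tau>)) x *\<^sub>R norm (u0 x) powr 1)"
    proof (cases "0 \<le> parabolic_form \<tau> (0, x)")
      case True
      hence "norm x \<le> sqrt \<tau>"
        using parabolic_form_nonneg_bounds(2)[OF assms(2) True] by (auto intro: real_le_rsqrt)
      moreover have "norm (u0 x) * \<bar>flat 0 (parabolic_form \<tau> (0, x))\<bar> \<le> norm (u0 x) * 1"
        using flat_0_le_1 flat_nonneg by (intro mult_left_mono) auto
      ultimately show ?thesis by (simp add: parabolic_bump_def norm_mult)
    qed (simp add: parabolic_bump_def flat_def)
  qed
qed

text \<open>
  The real part of the weak formulation, tested with the bump. The integral of the nonlinear term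
  is at least the integral of \<open>\<mu> * \<bar>u\<bar> powr p * \<psi>\<close>, and the term with derivatives of \<open>\<psi>\<close> is at
  most this integral plus a remainder that no longer contains \<open>u\<close>; hence the solution disappears.
  The remainder is a constant times \<open>\<tau> powr (- (1 + d / 2))\<close> times the volume of the parabolic box, and the powers
  of \<open>\<tau>\<close> cancel.
\<close>

lemma test_function_estimate:
  fixes u :: "real \<times> 'a::euclidean_space \<Rightarrow> complex"
  defines "d \<equiv> real DIM('a)"
  assumes sol: "weak_solution F T u0 u" and \<tau>: "0 < \<tau>" "\<tau> < T" and "0 < \<mu>" "0 < B"
    and F: "\<And>z. \<mu> * norm z powr (1 + 2 / d) \<le> Re (F z)"
    and B: "\<And>z::real \<times> 'a. norm (- \<i> * time_deriv (parabolic_bump \<tau>) z + space_laplacian (parabolic_bump \<tau>) z)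
      \<le> B / \<tau> * flat 0 (parabolic_form \<tau> z) powr (1 - 2 / (d + 2))"
  shows "(LINT x|lebesgue. - Im (u0 x) * flat 0 (parabolic_form \<tau> (0, x)))
    \<le> \<mu> powr (- (d / 2)) * B powr (1 + d / 2) * 2 ^ (DIM('a) + 1)"
proof -
  define S :: "(real \<times> 'a) set" where "S = {0<..<T} \<times> UNIV"
  define D :: "real \<times> 'a \<Rightarrow> complex" where "D z = - \<i> * time_deriv (parabolic_bump \<tau>) z + space_laplacian (parabolic_bump \<tau>) z" for z
  define h1 where "h1 z = indicator S z *\<^sub>R (u z * D z)" for z
  define h2 where "h2 z = indicator S z *\<^sub>R (F (u z) * parabolic_bump \<tau> z)" for z
  define c where "c = \<mu> powr (- (d / 2)) * (B / \<tau>) powr (1 + d / 2)"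
  have d: "d > 0" by (simp add: d_def)
  have "parabolic_bump \<tau> \<in> test_functions ({..<T} \<times> (UNIV :: 'a set))"
    using \<tau> by (rule parabolic_bump_test_function)
  hence int1: "integrable lebesgue h1" and int2: "integrable lebesgue h2" and
    id: "integral\<^sup>L lebesgue h1 = \<i> * (LINT x|lebesgue. u0 x * parabolic_bump \<tau> (0, x)) + integral\<^sup>L lebesgue h2"
    using sol unfolding weak_solution_def set_integrable_def set_lebesgue_integral_def
      h1_def h2_def D_def S_def by blast+
  have int0: "integrable lebesgue (\<lambda>x. u0 x * parabolic_bump \<tau> (0, x))"
    using sol \<tau> by (intro integrable_initial) (auto simp: weak_solution_def)
  have "(LINT x|lebesgue. - Im (u0 x) * flat 0 (parabolic_form \<tau> (0, x))) = (LINT x|lebesgue. - Im (u0 x * parabolic_bump \<tau> (0, x)))"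
    by (simp add: parabolic_bump_def)
  also have "\<dots> = - Im (LINT x|lebesgue. u0 x * parabolic_bump \<tau> (0, x))"
    unfolding Bochner_Integration.integral_minus integral_Im[OF int0] ..
  also have "\<dots> = Re (integral\<^sup>L lebesgue h1) - Re (integral\<^sup>L lebesgue h2)"
    using id by simp
  also have "\<dots> = (LINT z|lebesgue. Re (h1 z) - Re (h2 z))"
    using int1 int2 by simp
  \<comment> \<open>The integrands are compared pointwise as a difference: the weak formulation provides
    directly the integrability of \<open>F u * \<psi>\<close>, not of \<open>\<bar>u\<bar> powr p * \<psi>\<close>.\<close>
  also have "\<dots> \<le> (LINT z|lebesgue. indicator (parabolic_box \<tau> :: (real \<times> 'a) set) z * c)"
  proof (rule Bochner_Integration.integral_mono)
    show "integrable lebesgue (\<lambda>z. Re (h1 z) - Re (h2 z))"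
      using int1 int2 by simp
    have "(parabolic_box \<tau> :: (real \<times> 'a) set) \<in> lmeasurable"
      unfolding parabolic_box_def by (rule lmeasurable_cbox)
    thus "integrable lebesgue (\<lambda>z :: real \<times> 'a. indicator (parabolic_box \<tau>) z * c)"
      by (intro integrable_mult_left integrable_real_indicator) (auto simp: fmeasurable_def)
    fix z :: "real \<times> 'a"
    define W where "W = flat 0 (parabolic_form \<tau> z)"
    have W: "W \<ge> 0" by (simp add: W_def flat_nonneg)
    have c: "c \<ge> 0" using assms by (simp add: c_def)
    have Dle: "norm (D z) \<le> B / \<tau> * W powr (1 - 2 / (d + 2))"
      using B by (simp add: D_def W_def)
    show "Re (h1 z) - Re (h2 z) \<le> indicator (parabolic_box \<tau>) z * c"
    proof (cases "W = 0")
      case True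
      hence "D z = 0" "parabolic_bump \<tau> z = 0"
        using Dle by (auto simp: parabolic_bump_def W_def)
      thus ?thesis using c by (simp add: h1_def h2_def)
    next
      case False
      hence "0 \<le> parabolic_form \<tau> z" by (auto simp: W_def flat_def split: if_splits)
      hence box: "z \<in> parabolic_box \<tau>" using \<tau> by (intro parabolic_form_nonneg_in_parabolic_box)
      define a where "a = norm (u z) * W powr (1 - 2 / (d + 2))"
      have "Re (u z * D z) \<le> norm (u z) * norm (D z)"
        using complex_Re_le_cmod[of "u z * D z"] by (simp add: norm_mult)
      also have "\<dots> \<le> a * (B / \<tau>)"
        using mult_left_mono[OF Dle norm_ge_zero[of "u z"]] by (simp add: a_def mult_ac)
      also have "\<dots> \<le> \<mu> * a powr (1 + 2 / d) + c"
        unfolding c_def using assms d W by (intro young_power) (auto simp: a_def)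
      also have "a powr (1 + 2 / d) = norm (u z) powr (1 + 2 / d) * W"
      proof -
        have "1 - 2 / (d + 2) = d / (d + 2)" "1 + 2 / d = (d + 2) / d"
          using d by (auto simp: field_simps)
        hence "(1 - 2 / (d + 2)) * (1 + 2 / d) = 1"
          using d by simp
        thus ?thesis
          using W by (simp add: a_def powr_mult powr_powr)
      qed
      also have "\<mu> * (norm (u z) powr (1 + 2 / d) * W) \<le> Re (F (u z)) * W"
        using mult_right_mono[OF F W] by (simp add: mult.assoc)
      finally have "Re (u z * D z) \<le> Re (F (u z) * parabolic_bump \<tau> z) + c"
        by (simp add: parabolic_bump_def W_def)
      thus ?thesis
        using box c by (simp add: h1_def h2_def indicator_def)
    qed
  qed
  also have "\<dots> = measure lebesgue (parabolic_box \<tau> :: (real \<times> 'a) set) * c"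
    by simp
  also have "\<dots> = \<mu> powr (- (d / 2)) * (B powr (1 + d / 2) / \<tau> powr (1 + d / 2)) *
      (2 ^ (DIM('a) + 1) * \<tau> powr ((d + 2) / 2))"
    using \<tau> \<open>0 < B\<close> by (simp add: measure_parabolic_box c_def d_def powr_divide)
  also have "(d + 2) / 2 = 1 + d / 2" by (simp add: field_simps)
  finally show ?thesis using \<tau> by (simp add: mult_ac)
qed

section \<open>Mass of the initial datum\<close>

lemma measure_annulus:
  assumes "0 < r"
  shows "measure lebesgue (cball 0 (2 * r) - cball (0::'a::euclidean_space) r)
    \<ge> measure lebesgue (ball (0::'a) 1) * r ^ DIM('a)"
proof -
  have *: "measure lebesgue (cball (0::'a) s) = s ^ DIM('a) * measure lebesgue (ball (0::'a) 1)" if "s > 0" for s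
    using content_ball_conv_unit_ball[of s "0::'a"] that by (simp add: content_cball_conv_ball)
  have "measure lebesgue (cball 0 (2 * r) - cball (0::'a) r)
      = measure lebesgue (cball (0::'a) (2 * r)) - measure lebesgue (cball (0::'a) r)"
    using assms by (intro measurable_measure_Diff) auto
  also have "\<dots> = (2 ^ DIM('a) - 1) * (r ^ DIM('a) * measure lebesgue (ball (0::'a) 1))"
    unfolding *[OF assms] *[OF mult_pos_pos[OF zero_less_numeral assms]]
    by (simp only: power_mult_distrib) (simp add: algebra_simps)
  also have "\<dots> \<ge> 1 * (r ^ DIM('a) * measure lebesgue (ball (0::'a) 1))"
  proof (intro mult_right_mono)
    have "(2::real) ^ 1 \<le> 2 ^ DIM('a)" by (intro power_increasing) auto
    thus "1 \<le> (2::real) ^ DIM('a) - 1" by simp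
  qed (use assms in auto)
  finally show ?thesis by (simp add: mult.commute)
qed

lemma powr_annulus:
  fixes r y k :: real
  assumes "0 < r" "r \<le> y" "y \<le> 2 * r"
  shows "min 1 (2 powr (- k)) * r powr (- k) \<le> y powr (- k)"
proof (cases "k \<ge> 0")
  case True
  have "min 1 (2 powr (- k)) * r powr (- k) \<le> 2 powr (- k) * r powr (- k)"
    by (intro mult_right_mono) auto
  also have "\<dots> = (2 * r) powr (- k)" using assms by (simp add: powr_mult)
  also have "\<dots> \<le> y powr (- k)"
    using assms True by (intro powr_mono2') auto
  finally show ?thesis .
next
  case False
  have "min 1 (2 powr (- k)) * r powr (- k) \<le> 1 * r powr (- k)"
    by (intro mult_right_mono) auto
  also have "\<dots> \<le> y powr (- k)"
    using assms False by (simp add: powr_mono2)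
  finally show ?thesis .
qed

text \<open>
  The mass of the initial datum is collected on \<open>N\<close> dyadic annuli. For \<open>k < d\<close> a single annulus of
  radius comparable to \<open>sqrt \<tau>\<close> already carries a mass of the right order. For \<open>k = d\<close> all annuli
  contribute equally, and their number produces the logarithm of \<open>\<tau>\<close>.
\<close>

lemma initial_data_lower_bound:
  fixes g :: "'a::euclidean_space \<Rightarrow> real" and N :: nat and k R0 r \<tau> :: real
  defines "v \<equiv> measure lebesgue (ball (0::'a) 1)"
  assumes int: "integrable lebesgue (\<lambda>x. g x * flat 0 (parabolic_form \<tau> (0, x)))"
    and g: "AE x in lebesgue. g x \<ge> (if norm x > R0 then norm x powr (- k) else 0)"
    and r: "0 < r" "R0 \<le> r" "2 ^ N * r \<le> sqrt \<tau> / 2"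
  shows "flat 0 (3 / 4) * min 1 (2 powr (- k)) * v * (\<Sum>j<N. (2 ^ j * r) powr (real DIM('a) - k))
    \<le> (LINT x|lebesgue. g x * flat 0 (parabolic_form \<tau> (0, x)))"
proof -
  define e where "e = flat 0 (3 / 4)"
  define m where "m = min 1 (2 powr (- k))"
  define s where "s j = 2 ^ j * r" for j :: nat
  define A :: "nat \<Rightarrow> 'a set" where "A j = cball 0 (2 * s j) - cball 0 (s j)" for j
  define b where "b j = e * m * s j powr (- k)" for j
  have s: "s j > 0" for j using r by (simp add: s_def)
  have e: "e \<ge> 0" by (simp add: e_def flat_nonneg)
  have m: "m \<ge> 0" by (simp add: m_def)
  have "\<tau> > 0"
  proof -
    have "0 < 2 ^ N * r" using r by simp
    hence "0 < sqrt \<tau>" using r(3) by linarith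
    thus ?thesis by simp
  qed
  have Aint: "integrable lebesgue (\<lambda>x. b j * indicat_real (A j) x)" for j
  proof -
    have "A j \<in> lmeasurable" unfolding A_def by (intro fmeasurable.Diff) auto
    thus ?thesis by (intro integrable_mult_right integrable_real_indicator) (auto simp: fmeasurable_def)
  qed
  have "e * m * v * (\<Sum>j<N. s j powr (real DIM('a) - k)) = (\<Sum>j<N. b j * (v * s j ^ DIM('a)))"
    unfolding sum_distrib_left
  proof (intro sum.cong refl)
    fix j
    have "s j powr (real DIM('a) - k) = s j powr (- k) * s j ^ DIM('a)"
      using s[of j] by (simp add: powr_realpow[symmetric] flip: powr_add)
    thus "e * m * v * s j powr (real DIM('a) - k) = b j * (v * s j ^ DIM('a))"
      by (simp add: b_def)
  qed
  also have "\<dots> \<le> (\<Sum>j<N. b j * measure lebesgue (A j))"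
    unfolding A_def v_def b_def using e m
    by (intro sum_mono mult_left_mono measure_annulus s) auto
  also have "\<dots> = (LINT x|lebesgue. (\<Sum>j<N. b j * indicat_real (A j) x))"
    using Aint by (subst Bochner_Integration.integral_sum) auto
  also have "\<dots> \<le> (LINT x|lebesgue. g x * flat 0 (parabolic_form \<tau> (0, x)))"
  proof (rule integral_mono_AE)
    show "integrable lebesgue (\<lambda>x. \<Sum>j<N. b j * indicat_real (A j) x)"
      using Aint by (intro Bochner_Integration.integrable_sum)
    show "AE x in lebesgue. (\<Sum>j<N. b j * indicat_real (A j) x) \<le> g x * flat 0 (parabolic_form \<tau> (0, x))"
      using g
    proof eventually_elim
      case (elim x)
      hence g0: "0 \<le> g x" by (auto split: if_splits intro: order_trans[OF powr_ge_zero])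
      show ?case
      proof (cases "\<exists>j<N. x \<in> A j")
        case False
        hence "(\<Sum>j<N. b j * indicat_real (A j) x) = 0" by (intro sum.neutral) auto
        thus ?thesis using g0 by (simp add: flat_nonneg)
      next
        case True
        then obtain j where j: "j < N" "x \<in> A j" by blast
        hence x: "s j < norm x" "norm x \<le> 2 * s j" by (auto simp: A_def)
        have disj: "x \<notin> A i" if "i \<noteq> j" for i
        proof (cases "i < j")
          case True
          hence "2 ^ Suc i * r \<le> 2 ^ j * r"
            using r by (intro mult_right_mono power_increasing) auto
          thus ?thesis using x by (auto simp: A_def s_def)
        next
          case False
          hence "2 ^ Suc j * r \<le> 2 ^ i * r"
            using r that by (intro mult_right_mono power_increasing) auto
          thus ?thesis using x by (auto simp: A_def s_def)
        qed
        have "(\<Sum>i<N. b i * indicat_real (A i) x) = (\<Sum>i<N. if i = j then b j else 0)"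
          using disj j by (intro sum.cong) auto
        also have "\<dots> = b j" using j by simp
        also have "\<dots> = (m * s j powr (- k)) * e" by (simp add: b_def)
        also have "\<dots> \<le> g x * flat 0 (parabolic_form \<tau> (0, x))"
        proof (intro mult_mono)
          have "m * s j powr (- k) \<le> norm x powr (- k)"
            unfolding m_def using s x by (intro powr_annulus) auto
          moreover have "1 * r \<le> 2 ^ j * r" using r by (intro mult_right_mono) auto
          hence "norm x > R0" using r(2) x(1) unfolding s_def by linarith
          ultimately show "m * s j powr (- k) \<le> g x" using elim by simp
          have "2 ^ Suc j * r \<le> 2 ^ N * r"
            using r j by (intro mult_right_mono power_increasing) auto
          moreover have "2 ^ Suc j * r = 2 * s j" by (simp add: s_def)
          ultimately have "norm x \<le> sqrt \<tau> / 2" using x(2) r(3) by linarith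
          hence "(norm x)\<^sup>2 \<le> (sqrt \<tau> / 2)\<^sup>2" by (intro power_mono) auto
          \<comment> \<open>The last annulus stays in the ball of radius \<open>sqrt \<tau> / 2\<close>, where the bump is at
            least \<open>flat 0 (1 - 1 / 4)\<close>.\<close>
          hence "3 / 4 \<le> parabolic_form \<tau> (0, x)"
            using \<open>\<tau> > 0\<close> by (simp add: parabolic_form_0 power_divide field_simps)
          thus "e \<le> flat 0 (parabolic_form \<tau> (0, x))" unfolding e_def by (rule flat_0_mono)
        qed (use g0 e in auto)
        finally show ?thesis .
      qed
    qed
  qed (rule int)
  finally show ?thesis by (simp add: e_def m_def s_def)
qed

section \<open>The lifespan bound\<close>

theorem theorem1p10:
  fixes k R0 \<mu> :: real
  assumes "k \<le> real DIM('a::euclidean_space)" and "R0 > 0" and "\<mu> > 0"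
  shows "\<exists>C>0. \<forall>(F :: complex \<Rightarrow> complex) (f :: 'a \<Rightarrow> complex).
    critical_nonlinearity DIM('a) F \<and>
    (\<lambda>n. norm (fourier_coeff F n)) summable_on UNIV \<and>
    fourier_coeff F 0 = 1 \<and>
    complex_of_real \<mu> =
      fourier_coeff F 0 - complex_of_real (\<Sum>\<^sub>\<infinity>n\<in>{n. n \<noteq> 0}. norm (fourier_coeff F n)) \<and>
    Lp_loc 1 UNIV f \<and>
    (AE x in lebesgue. - Im (f x) \<ge> (if norm x > R0 then norm x powr (- k) else 0))
    \<longrightarrow> (\<exists>\<epsilon>0>0. \<forall>\<epsilon>. 0 < \<epsilon> \<and> \<epsilon> < \<epsilon>0 \<longrightarrow>
          T_max F (\<lambda>x. complex_of_real \<epsilon> * f x) \<le>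
            (if k < real DIM('a)
             then ennreal (C * \<epsilon> powr (- 2 / (real DIM('a) - k)))
             else ennreal (exp (C / \<epsilon>))))"
proof -
  define d where "d = real DIM('a)"
  have d: "d > 0" by (simp add: d_def)
  obtain B where "B > 0" and B: "\<forall>\<tau>>0. \<forall>z::real \<times> 'a.
    norm (- \<i> * time_deriv (parabolic_bump \<tau>) z + space_laplacian (parabolic_bump \<tau>) z)
      \<le> B / \<tau> * flat 0 (parabolic_form \<tau> z) powr (1 - 2 / (d + 2))"
    using bump_operator_bound[of "2 / (d + 2)", where ?'a = 'a] d by auto
  define M where "M = \<mu> powr (- (d / 2)) * B powr (1 + d / 2) * 2 ^ (DIM('a) + 1)"
  define \<kappa> where "\<kappa> = flat 0 (3 / 4) * min 1 (2 powr (- k)) * measure lebesgue (ball (0::'a) 1)"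
  define H :: "(complex \<Rightarrow> complex) \<Rightarrow> ('a \<Rightarrow> complex) \<Rightarrow> bool" where
    "H F f \<longleftrightarrow> (critical_nonlinearity DIM('a) F \<and>
      (\<lambda>n. norm (fourier_coeff F n)) summable_on UNIV \<and>
      fourier_coeff F 0 = 1 \<and>
      complex_of_real \<mu> =
        fourier_coeff F 0 - complex_of_real (\<Sum>\<^sub>\<infinity>n\<in>{n. n \<noteq> 0}. norm (fourier_coeff F n))) \<and>
      (AE x in lebesgue. - Im (f x) \<ge> (if norm x > R0 then norm x powr (- k) else 0))" for F f
  have M: "M \<ge> 0" using assms by (simp add: M_def)
  have \<kappa>: "\<kappa> > 0"
    unfolding \<kappa>_def by (intro mult_pos_pos content_ball_pos) (auto simp: flat_def min_def)
  \<comment> \<open>A solution living beyond time \<open>\<tau>\<close> can be tested with the bump at scale \<open>\<tau>\<close>, which forces the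
    mass of the datum at that scale to be at most \<open>M\<close>. It remains to choose \<open>\<tau>\<close> as the claimed bound
    and to see that the mass exceeds \<open>M\<close>.\<close>
  have T_max_le: "T_max F (\<lambda>x. complex_of_real \<epsilon> * f x) \<le> ennreal \<tau>"
    if H: "H F f"
    and \<tau>: "0 < \<tau>" "R0 \<le> r" "2 ^ N * r \<le> sqrt \<tau> / 2" and \<epsilon>: "0 < \<epsilon>"
    and large: "M < \<epsilon> * (\<kappa> * (\<Sum>j<N. (2 ^ j * r) powr (d - k)))"
    for F f \<tau> r \<epsilon> N
  proof -
    note F = H[unfolded H_def, THEN conjunct1] and f = H[unfolded H_def, THEN conjunct2]
    let ?u0 = "\<lambda>x. complex_of_real \<epsilon> * f x"
    have "T \<le> \<tau>" if sol: "weak_solution F T ?u0 u" for T u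
    proof (rule ccontr)
      assume "\<not> T \<le> \<tau>"
      hence "\<tau> < T" by simp
      have "(LINT x|lebesgue. - Im (?u0 x) * flat 0 (parabolic_form \<tau> (0, x))) \<le> M"
        unfolding M_def d_def
        by (rule test_function_estimate[OF sol \<tau>(1) \<open>\<tau> < T\<close> \<open>\<mu> > 0\<close> \<open>B > 0\<close>])
          (use B \<tau> Re_nonlinearity_lower_bound[of "DIM('a)" F \<mu>] F in \<open>auto simp: d_def\<close>)
      also have "(\<lambda>x. - Im (?u0 x) * flat 0 (parabolic_form \<tau> (0, x))) =
          (\<lambda>x. \<epsilon> * (- Im (f x) * flat 0 (parabolic_form \<tau> (0, x))))"
        by (simp add: fun_eq_iff)
      finally have "\<epsilon> * (LINT x|lebesgue. - Im (f x) * flat 0 (parabolic_form \<tau> (0, x))) \<le> M"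
        by simp
      moreover have "\<kappa> * (\<Sum>j<N. (2 ^ j * r) powr (d - k))
          \<le> (LINT x|lebesgue. - Im (f x) * flat 0 (parabolic_form \<tau> (0, x)))"
        unfolding \<kappa>_def d_def
      proof (rule initial_data_lower_bound)
        have "integrable lebesgue (\<lambda>x. ?u0 x * parabolic_bump \<tau> (0, x))"
          using sol \<tau> by (intro integrable_initial) (auto simp: weak_solution_def)
        hence "integrable lebesgue (\<lambda>x. - (1 / \<epsilon>) * Im (?u0 x * parabolic_bump \<tau> (0, x)))"
          by (intro integrable_mult_right integrable_Im)
        thus "integrable lebesgue (\<lambda>x. - Im (f x) * flat 0 (parabolic_form \<tau> (0, x)))"
          using \<epsilon> by (simp add: parabolic_bump_def)
      qed (use f \<tau> assms in auto)
      hence "\<epsilon> * (\<kappa> * (\<Sum>j<N. (2 ^ j * r) powr (d - k)))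
          \<le> \<epsilon> * (LINT x|lebesgue. - Im (f x) * flat 0 (parabolic_form \<tau> (0, x)))"
        using \<epsilon> by (intro mult_left_mono) auto
      ultimately show False using large by simp
    qed
    thus ?thesis
      unfolding T_max_def by (intro Sup_least) (auto intro: ennreal_leI)
  qed
  show ?thesis
  proof (cases "k < d")
    case True
    define \<delta> where "\<delta> = d - k"
    have \<delta>: "\<delta> > 0" using True by (simp add: \<delta>_def)
    define C where "C = (4 powr \<delta> * (M + 1) / \<kappa>) powr (2 / \<delta>)"
    have C: "C > 0" using M \<kappa> by (simp add: C_def add_nonneg_eq_0_iff)
    \<comment> \<open>The choice makes \<open>sqrt \<tau> / 4 \<ge> R0\<close>, so that the annulus lies where the datum is bounded below.\<close>
    define \<epsilon>0 where "\<epsilon>0 = (C / (16 * R0\<^sup>2)) powr (\<delta> / 2)"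
    have "\<epsilon>0 > 0" using C assms by (simp add: \<epsilon>0_def)
    have bound: "T_max F (\<lambda>x. complex_of_real \<epsilon> * f x) \<le> ennreal (C * \<epsilon> powr (- 2 / (d - k)))"
      if H: "H F f"
      and \<epsilon>: "0 < \<epsilon>" "\<epsilon> < \<epsilon>0" for F f \<epsilon>
    proof -
      define \<tau> where "\<tau> = C * \<epsilon> powr (- 2 / \<delta>)"
      have \<tau>: "\<tau> > 0" using C \<epsilon> by (simp add: \<tau>_def)
      have "T_max F (\<lambda>x. complex_of_real \<epsilon> * f x) \<le> ennreal \<tau>"
      proof (rule T_max_le[OF H \<tau>, where r = "sqrt \<tau> / 4" and N = 1])
        have "\<epsilon> powr (2 / \<delta>) \<le> \<epsilon>0 powr (2 / \<delta>)"
          using \<epsilon> \<delta> by (intro powr_mono2) auto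
        also have "\<dots> = C / (16 * R0\<^sup>2)"
          using \<delta> C assms by (simp add: \<epsilon>0_def powr_powr)
        finally have "16 * R0\<^sup>2 \<le> C / \<epsilon> powr (2 / \<delta>)"
          using assms \<epsilon> by (simp add: field_simps)
        hence "(4 * R0)\<^sup>2 \<le> \<tau>"
          by (simp add: \<tau>_def powr_minus_divide power2_eq_square)
        hence "4 * R0 \<le> sqrt \<tau>" by (rule real_le_rsqrt)
        thus "R0 \<le> sqrt \<tau> / 4" by simp
        have "(sqrt \<tau> / 4) powr \<delta> = \<tau> powr (\<delta> / 2) / 4 powr \<delta>"
          using \<tau> by (simp add: powr_divide powr_half_sqrt[symmetric] powr_powr)
        also have "\<tau> powr (\<delta> / 2) = (4 powr \<delta> * (M + 1) / \<kappa>) / \<epsilon>"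
        proof -
          define X where "X = 4 powr \<delta> * (M + 1) / \<kappa>"
          have X: "X > 0" using M \<kappa> by (simp add: X_def)
          have "\<tau> powr (\<delta> / 2) = X powr (2 / \<delta> * (\<delta> / 2)) * \<epsilon> powr (- 2 / \<delta> * (\<delta> / 2))"
            unfolding \<tau>_def C_def X_def[symmetric] by (subst powr_mult) (simp_all only: powr_ge_zero powr_powr)
          also have "2 / \<delta> * (\<delta> / 2) = 1" using \<delta> by simp
          also have "- 2 / \<delta> * (\<delta> / 2) = - 1" using \<delta> by simp
          finally show ?thesis using X \<epsilon> unfolding X_def[symmetric] by (simp add: powr_minus_divide)
        qed
        also have "4 powr \<delta> * (M + 1) / \<kappa> / \<epsilon> / 4 powr \<delta> = (M + 1) / \<kappa> / \<epsilon>"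
          by simp
        finally have "\<epsilon> * (\<kappa> * (sqrt \<tau> / 4) powr \<delta>) = M + 1"
          using \<epsilon> \<kappa> by simp
        thus "M < \<epsilon> * (\<kappa> * (\<Sum>j<1. (2 ^ j * (sqrt \<tau> / 4)) powr (d - k)))"
          by (simp add: \<delta>_def)
      qed (use \<epsilon> in auto)
      thus ?thesis by (simp add: \<tau>_def \<delta>_def)
    qed
    show ?thesis
      using True C \<open>\<epsilon>0 > 0\<close> bound unfolding d_def H_def by (intro exI[of _ C]) auto
  next
    case False
    hence k: "k = d" using assms by (simp add: d_def)
    define C where "C = 2 * ln 2 * (M + 1) / \<kappa>"
    have C: "C > 0" using M \<kappa> by (simp add: C_def)
    \<comment> \<open>The number of dyadic annuli between \<open>R0\<close> and \<open>sqrt \<tau> / 2\<close> is at least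
      \<open>log 2 (sqrt \<tau>) - log 2 (4 * R0)\<close>; the choice makes the loss from the second term less
      than \<open>1\<close>, which is the slack in \<open>M + 1\<close>.\<close>
    define \<epsilon>0 where "\<epsilon>0 = 1 / (\<kappa> * (\<bar>log 2 (4 * R0)\<bar> + 1))"
    have "\<epsilon>0 > 0" using \<kappa> by (simp add: \<epsilon>0_def)
    have bound: "T_max F (\<lambda>x. complex_of_real \<epsilon> * f x) \<le> ennreal (exp (C / \<epsilon>))"
      if H: "H F f"
      and \<epsilon>: "0 < \<epsilon>" "\<epsilon> < \<epsilon>0" for F f \<epsilon>
    proof -
      define \<tau> where "\<tau> = exp (C / \<epsilon>)"
      define L where "L = log 2 (sqrt \<tau> / (2 * R0))"
      define N where "N = nat \<lfloor>L\<rfloor>"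
      have small: "\<epsilon> * \<kappa> * (\<bar>log 2 (4 * R0)\<bar> + 1) < 1"
      proof -
        have "0 < \<kappa> * (\<bar>log 2 (4 * R0)\<bar> + 1)" using \<kappa> by (intro mult_pos_pos) auto
        thus ?thesis using \<epsilon> by (simp only: \<epsilon>0_def pos_less_divide_eq mult.assoc)
      qed
      have log4: "log 2 (4 * R0) = log 2 (2 * R0) + 1"
        using assms log_mult[of 2 "2 * R0" 2] by simp
      have "log 2 (sqrt \<tau>) = (M + 1) / (\<kappa> * \<epsilon>)"
        by (simp add: \<tau>_def C_def log_def ln_sqrt)
      hence L: "L = (M + 1) / (\<kappa> * \<epsilon>) - log 2 (4 * R0) + 1"
        using assms log4 by (simp add: L_def log_divide \<tau>_def)
      hence \<epsilon>L: "\<epsilon> * \<kappa> * (L - 1) = M + 1 - \<epsilon> * \<kappa> * log 2 (4 * R0)"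
        using \<epsilon> \<kappa> by (simp add: field_simps)
      have "\<epsilon> * \<kappa> * log 2 (4 * R0) \<le> \<epsilon> * \<kappa> * (\<bar>log 2 (4 * R0)\<bar> + 1)"
        using \<epsilon> \<kappa> by (intro mult_left_mono) auto
      hence gt: "M < \<epsilon> * \<kappa> * (L - 1)" using small \<epsilon>L by simp
      hence "0 < \<epsilon> * \<kappa> * (L - 1)" using M by simp
      hence "0 < L - 1" by (rule zero_less_mult_pos) (use \<epsilon> \<kappa> in simp)
      hence "L > 1" by simp
      hence N: "real N \<le> L" "L - 1 < real N" unfolding N_def by linarith+
      have "T_max F (\<lambda>x. complex_of_real \<epsilon> * f x) \<le> ennreal \<tau>"
      proof (rule T_max_le[OF H, where r = R0 and N = N])
        have "2 ^ N = 2 powr real N" by (simp add: powr_realpow)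
        also have "\<dots> \<le> 2 powr L" using N by simp
        also have "\<dots> = sqrt \<tau> / (2 * R0)" using assms by (simp add: L_def \<tau>_def)
        finally show "2 ^ N * R0 \<le> sqrt \<tau> / 2" using assms by (simp add: field_simps)
        have "(\<Sum>j<N. (2 ^ j * R0) powr (d - k)) = real N"
          using assms by (simp add: k)
        moreover have "\<epsilon> * \<kappa> * (L - 1) \<le> \<epsilon> * \<kappa> * real N"
          using N \<epsilon> \<kappa> by (intro mult_left_mono) auto
        ultimately show "M < \<epsilon> * (\<kappa> * (\<Sum>j<N. (2 ^ j * R0) powr (d - k)))"
          using gt by (simp add: mult.assoc)
      qed (use \<epsilon> in \<open>auto simp: \<tau>_def\<close>)
      thus ?thesis by (simp add: \<tau>_def)
    qed
    show ?thesis
      using False C \<open>\<epsilon>0 > 0\<close> bound unfolding d_def H_def by (intro exI[of _ C]) auto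
  qed
qed

end
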